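(* Let $\vec v=(v_1,v_2,v_3)$ and let $M$ be a cylindrical surface in $\mathbb{E}_1^3$, with direction of the rulings $w$ normalized to be $(1,0,0)$, $(0,0,1)$ or $(1,0,1)$ as described in the context. If $M$ is a translating soliton with respect to $\vec v$, then $M$ is a plane parallel to $\vec v$ or $M$ must be one of the next three cases. (1) Spacelike rulings. Let $w=(1,0,0)$. Then $M$ parametrizes as $X(s,t)=(0,s,u(s))+t\,w$, where $$-u''=\begin{cases}-(1-u'^2)(v_2u'-v_3), & \text{if } 1-u'^2>0,\\ (1-u'^2)(v_2u'-v_3), & \text{if } 1-u'^2<0.\end{cases}$$ (2) Timelike rulings. Let $w=(0,0,1)$. Then $M$ parametrizes as $X(s,t)=(s,u(s),0)+t\,w$, where $$u''=(1+u'^2)(v_2-v_1u').$$ (3) Lightlike rulings. Let $w=(1,0,1)$. Then either $M$ is a plane parallel to $\vec v$, or $\vec v$ is parallel to the rulings and the base curve is arbitrary.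
   Context: $\mathbb{E}_1^3$ is $\mathbb{R}^3$ with coordinates $(x,y,z)$ and metric $\langle\,,\rangle=dx^2+dy^2-dz^2$. A nonzero vector $a$ is spacelike, timelike or lightlike if $\langle a,a\rangle$ is $>0$, $<0$ or $=0$, respectively. A surface is non-degenerate if its induced metric is non-degenerate. For a non-degenerate surface let $N$ be the unit normal vector field, $\epsilon=\langle N,N\rangle\in\{-1,1\}$, and $\sigma$ the second fundamental form, $\nabla^0_UV=\nabla_UV+\sigma(U,V)$, where $\nabla^0$ and $\nabla$ are the Levi-Civita connections of $\mathbb{E}_1^3$ and of the surface. The mean curvature vector is $\vec H=\frac12\,\mathrm{trace}(\sigma)$, and the mean curvature $H$ is defined by $\vec H=HN$. A translating soliton with respect to a vector $\vec v$ (the velocity) is a non-degenerate surface with $2H=\langle N,\vec v\rangle$ at every point. A cylindrical surface is a surface $X(s,t)=\gamma(s)+t\,w$, $s\in I\subset\mathbb{R}$, $t\in\mathbb{R}$, where $w\neq0$ is a constant vector (the direction of the rulings) and $\gamma$ is a curve (the base curve). After a rigid motion of $\mathbb{E}_1^3$ it is assumed that $w=(1,0,0)$ with $\gamma$ contained in the $yz$-plane, or $w=(0,0,1)$ with $\gamma$ contained in the $xy$-plane, or $w=(1,0,1)$ with $\gamma$ contained in the plane spanned by $(0,1,0)$ and $(1,0,-1)$.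
   Formalization: In (1) and (2) the parametrization by u with its ODE is asserted on each interval where the base curve has no vertical tangent (all of I if none), vertical points being isolated; globally it fails, e.g. x = -ln cos y, v=(1,0,0), w=(0,0,1). "Plane" means an open part of a plane. *)

theory Defs
  imports "HOL-Analysis.Analysis"
begin

definition lorentz :: "real^3 \<Rightarrow> real^3 \<Rightarrow> real" where
  "lorentz a b = a $ 1 * b $ 1 + a $ 2 * b $ 2 - a $ 3 * b $ 3"

text \<open>Surfaces are given by a map \<open>X\<close> on an open set \<open>D\<close> of parameters
  \<open>p = (s, t)\<close>, \<open>s = p $ 1\<close>, \<open>t = p $ 2\<close>. They are immersed, not necessarily embedded.\<close>

definition partial :: "2 \<Rightarrow> (real^2 \<Rightarrow> 'a::real_normed_vector) \<Rightarrow> real^2 \<Rightarrow> 'a" where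
  "partial i f p = frechet_derivative f (at p) (axis i 1)"

definition C2_surface :: "(real^2 \<Rightarrow> real^3) \<Rightarrow> (real^2) set \<Rightarrow> bool" where
  "C2_surface X D \<longleftrightarrow> open D \<and>
     (\<forall>p\<in>D. X differentiable (at p)) \<and>
     (\<forall>i. \<forall>p\<in>D. partial i X differentiable (at p)) \<and>
     (\<forall>i j. continuous_on D (partial i (partial j X)))"

definition induced_metric :: "(real^2 \<Rightarrow> real^3) \<Rightarrow> real^2 \<Rightarrow> real^2^2" where
  "induced_metric X p = (\<chi> i j. lorentz (partial i X p) (partial j X p))"

definition nondegenerate_surface :: "(real^2 \<Rightarrow> real^3) \<Rightarrow> (real^2) set \<Rightarrow> bool" where
  "nondegenerate_surface X D \<longleftrightarrow> C2_surface X D \<and> (\<forall>p\<in>D. det (induced_metric X p) \<noteq> 0)"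

text \<open>The Levi-Civita connection of the surface in the coordinate frame:
  \<open>\<nabla>\<close> maps \<open>X_i, X_j\<close> to the sum over \<open>k\<close> of \<open>christoffel X k i j *\<^sub>R X_k\<close>.\<close>

definition christoffel :: "(real^2 \<Rightarrow> real^3) \<Rightarrow> 2 \<Rightarrow> 2 \<Rightarrow> 2 \<Rightarrow> real^2 \<Rightarrow> real" where
  "christoffel X k i j p = (\<Sum>l\<in>UNIV. matrix_inv (induced_metric X p) $ k $ l *
     (partial i (\<lambda>q. induced_metric X q $ j $ l) p
      + partial j (\<lambda>q. induced_metric X q $ i $ l) p
      - partial l (\<lambda>q. induced_metric X q $ i $ j) p)) / 2"

text \<open>Gauss formula on the coordinate frame; the ambient connection is componentwise
  differentiation.\<close>

definition second_fundamental_form ::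
    "(real^2 \<Rightarrow> real^3) \<Rightarrow> 2 \<Rightarrow> 2 \<Rightarrow> real^2 \<Rightarrow> real^3" where
  "second_fundamental_form X i j p =
     partial i (partial j X) p - (\<Sum>k\<in>UNIV. christoffel X k i j p *\<^sub>R partial k X p)"

definition mean_curvature_vector :: "(real^2 \<Rightarrow> real^3) \<Rightarrow> real^2 \<Rightarrow> real^3" where
  "mean_curvature_vector X p = (1/2) *\<^sub>R (\<Sum>i\<in>UNIV. \<Sum>j\<in>UNIV.
     matrix_inv (induced_metric X p) $ i $ j *\<^sub>R second_fundamental_form X i j p)"

definition unit_normal_field ::
    "(real^2 \<Rightarrow> real^3) \<Rightarrow> (real^2) set \<Rightarrow> (real^2 \<Rightarrow> real^3) \<Rightarrow> bool" where
  "unit_normal_field X D N \<longleftrightarrow> continuous_on D N \<and>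
     (\<forall>p\<in>D. lorentz (N p) (N p) \<in> {-1, 1} \<and> (\<forall>i. lorentz (N p) (partial i X p) = 0))"

text \<open>Replacing \<open>N\<close> by \<open>-N\<close> replaces \<open>H\<close> by \<open>-H\<close>, so the
  soliton equation does not depend on the choice of the unit normal field.\<close>

definition translating_soliton ::
    "(real^2 \<Rightarrow> real^3) \<Rightarrow> (real^2) set \<Rightarrow> real^3 \<Rightarrow> bool" where
  "translating_soliton X D v \<longleftrightarrow> nondegenerate_surface X D \<and>
     (\<exists>N H. unit_normal_field X D N \<and>
        (\<forall>p\<in>D. mean_curvature_vector X p = H p *\<^sub>R N p \<and> 2 * H p = lorentz (N p) v))"

definition cyl :: "(real \<Rightarrow> real^3) \<Rightarrow> real^3 \<Rightarrow> real^2 \<Rightarrow> real^3" where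
  "cyl \<gamma> w p = \<gamma> (p $ 1) + (p $ 2) *\<^sub>R w"

definition cyl_domain :: "real set \<Rightarrow> (real^2) set" where
  "cyl_domain I = {p. p $ 1 \<in> I}"

definition open_interval :: "real set \<Rightarrow> bool" where
  "open_interval I \<longleftrightarrow> open I \<and> is_interval I \<and> I \<noteq> {}"

definition C2_curve :: "(real \<Rightarrow> real^3) \<Rightarrow> real set \<Rightarrow> bool" where
  "C2_curve \<gamma> I \<longleftrightarrow>
     (\<forall>s\<in>I. \<gamma> differentiable (at s)) \<and>
     (\<forall>s\<in>I. (\<lambda>r. vector_derivative \<gamma> (at r)) differentiable (at s)) \<and>
     continuous_on I (\<lambda>s. vector_derivative (\<lambda>r. vector_derivative \<gamma> (at r)) (at s))"

text \<open>Regularity of the base curve is not required here: it follows from non-degeneracy of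
  the surface.\<close>

definition normalized_cylinder :: "(real \<Rightarrow> real^3) \<Rightarrow> real^3 \<Rightarrow> real set \<Rightarrow> bool" where
  "normalized_cylinder \<gamma> w I \<longleftrightarrow> open_interval I \<and> C2_curve \<gamma> I \<and>
     (w = vector [1, 0, 0] \<and> \<gamma> ` I \<subseteq> span {vector [0, 1, 0], vector [0, 0, 1]} \<or>
      w = vector [0, 0, 1] \<and> \<gamma> ` I \<subseteq> span {vector [1, 0, 0], vector [0, 1, 0]} \<or>
      w = vector [1, 0, 1] \<and> \<gamma> ` I \<subseteq> span {vector [0, 1, 0], vector [1, 0, -1]})"

text \<open>A cylinder over a curve defined on an arbitrary interval may be only a strip, so ``being a
  plane'' means being an open part of a plane. Parallelism to \<open>v\<close> is invariance of the
  whole plane under translation by \<open>v\<close>.\<close>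

definition plane_parallel_to :: "(real^3) set \<Rightarrow> real^3 \<Rightarrow> bool" where
  "plane_parallel_to M v \<longleftrightarrow>
     (\<exists>P. affine P \<and> aff_dim P = 2 \<and> openin (top_of_set P) M \<and> (\<forall>x\<in>P. x + v \<in> P))"

text \<open>The cylinder parametrizes as \<open>c s (u s) + t *\<^sub>R w\<close>, where \<open>s\<close> is the
  \<open>i\<close>-th coordinate and \<open>ode (u' s) (u'' s)\<close> holds. A graph \<open>u\<close> cannot be
  differentiable over a point where the \<open>i\<close>-th component of the tangent of the base curve
  vanishes, and such points do occur: for \<open>v = (1,0,0)\<close> and \<open>w = (0,0,1)\<close> at the
  apex of the grim reaper \<open>x = - ln (cos y)\<close>, for \<open>v = (0,1,0)\<close> and
  \<open>w = (1,0,0)\<close> at the apex of one of the timelike solitons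
  \<open>y = ln (cosh z)\<close>, \<open>y = - ln (cosh z)\<close>. Hence the parametrization is
  asserted on every interval free of such points (on all of \<open>I\<close> if there are none), and
  these points are required to be isolated, without accumulation in \<open>I\<close>.\<close>

definition vertical_points :: "3 \<Rightarrow> (real \<Rightarrow> real^3) \<Rightarrow> real set \<Rightarrow> real set" where
  "vertical_points i \<gamma> I = {s \<in> I. vector_derivative \<gamma> (at s) $ i = 0}"

definition parametrizes_as_graph ::
    "3 \<Rightarrow> (real \<Rightarrow> real \<Rightarrow> real^3) \<Rightarrow> (real \<Rightarrow> real \<Rightarrow> bool)
     \<Rightarrow> (real \<Rightarrow> real^3) \<Rightarrow> real^3 \<Rightarrow> real set \<Rightarrow> bool" where
  "parametrizes_as_graph i c ode \<gamma> w I \<longleftrightarrow>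
     (\<forall>s\<in>I. \<not> s islimpt vertical_points i \<gamma> I) \<and>
     (\<forall>J. open_interval J \<and> J \<subseteq> I - vertical_points i \<gamma> I \<longrightarrow>
        (\<exists>K u. open_interval K \<and>
           cyl \<gamma> w ` cyl_domain J = cyl (\<lambda>s. c s (u s)) w ` cyl_domain K \<and>
           (\<forall>s\<in>K. u differentiable (at s) \<and> deriv u differentiable (at s) \<and>
                  ode (deriv u s) (deriv (deriv u) s))))"

end

theory Submission
  imports Defs
begin

text \<open>All rulings of a cylinder \<open>\<gamma> s + t *\<^sub>R w\<close> have the same direction, so the metric depends on
  \<open>s\<close> alone and only the coefficient of the second fundamental form in the direction of the base
  curve survives. With \<open>G = lorentz w w\<close> and \<open>g\<close> the induced metric, the inverse metric has first
  entry \<open>G / det g\<close>, hence \<open>2 * det g * H\<close> is \<open>G\<close> times the normal component of the acceleration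
  of \<open>\<gamma>\<close> (\<open>det_times_mean_curvature_cyl\<close>, \<open>soliton_cyl_equation\<close>). Everything follows from this
  one identity.

  If the rulings are lightlike, \<open>G = 0\<close>: the surface has zero mean curvature whatever the base curve, and
  the soliton equation says that \<open>v\<close> is everywhere tangent. Either \<open>v\<close> is parallel to
  \<open>w\<close>, or \<open>v\<close> and \<open>w\<close> span all the tangent planes, which are then parallel, and the surface lies
  in a plane.

  If \<open>G \<noteq> 0\<close>, let \<open>a\<close> and \<open>b\<close> be the two components of the velocity of the base curve in its plane,
  \<open>a\<close> belonging to the coordinate that is to serve as parameter of the graph. Eliminating the normal
  turns the identity into \<open>a * b' - a' * b = W * (c * a + e * b)\<close> with \<open>W\<close> a nowhere vanishing
  continuous function and constants \<open>c\<close>, \<open>e\<close>, which are components of \<open>v\<close> up to sign. Where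
  \<open>a \<noteq> 0\<close> the curve is a graph with slope \<open>b / a\<close> and second derivative
  \<open>(a * b' - a' * b) / a^3\<close>, so the identity is the asserted differential equation
  (\<open>graph_reparametrization\<close>). If the zeros of \<open>a\<close> accumulate at a point of the interval, then
  \<open>a\<close> and \<open>a'\<close> vanish there, whence \<open>e = 0\<close>; now the identity is a homogeneous linear equation for
  \<open>a\<close> wherever \<open>b \<noteq> 0\<close>, so by uniqueness and connectedness \<open>a\<close> vanishes identically
  (\<open>accumulating_vertical_points_imp_all\<close>). In that case the surface lies in a plane on
  which the intended parameter is constant, and \<open>e = 0\<close> says precisely that \<open>v\<close> is parallel to it
  (\<open>cylinder_in_coordinate_plane\<close>).\<close>

section \<open>Mean curvature of a cylinder\<close>

lemma lorentz_commute: "lorentz a b = lorentz b a"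
  by (simp add: lorentz_def mult.commute)

lemma bounded_bilinear_lorentz: "bounded_bilinear lorentz"
proof -
  have *: "lorentz a b = inner a (\<chi> i. (if i = 3 then -1 else 1) * b $ i)" for a b
    by (simp add: lorentz_def inner_vec_def sum_3)
  have lin: "linear (\<lambda>b::real^3. \<chi> i. (if i = 3 then -1 else 1) * b $ i)"
    by (rule linearI) (auto simp: vec_eq_iff)
  have "bounded_bilinear (\<lambda>a b. inner a ((\<lambda>b::real^3. \<chi> i. (if i = 3 then -1 else 1) * b $ i) b))"
    using bounded_bilinear.comp[OF bounded_bilinear_inner bounded_linear_ident] lin
    by (simp add: linear_conv_bounded_linear)
  then show ?thesis
    by (simp add: *[abs_def])
qed

text \<open>Only this entry of the inverse metric contributes to the mean curvature of a cylinder.\<close>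

lemma matrix_inv_2_11:
  fixes A :: "real^2^2"
  assumes "det A \<noteq> 0"
  shows "det A * matrix_inv A $ 1 $ 1 = A $ 2 $ 2"
proof -
  define B where "B = matrix_inv A"
  have "\<exists>A'. A ** A' = mat 1 \<and> A' ** A = mat 1"
    using assms by (simp add: invertible_det_nz[symmetric] invertible_def)
  from someI_ex[OF this] have "A ** B = mat 1"
    unfolding B_def matrix_inv_def ..
  then have "(A ** B) $ 1 $ 1 = 1" "(A ** B) $ 2 $ 1 = 0"
    by (simp_all add: mat_def)
  then have *: "A$1$1 * B$1$1 + A$1$2 * B$2$1 = 1" "A$2$1 * B$1$1 + A$2$2 * B$2$1 = 0"
    by (simp_all add: matrix_matrix_mult_def sum_2)
  have "det A * B$1$1 = A$2$2 * (A$1$1 * B$1$1 + A$1$2 * B$2$1)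
      - A$1$2 * (A$2$1 * B$1$1 + A$2$2 * B$2$1)"
    by (simp add: det_2 algebra_simps)
  then show ?thesis
    using * by (simp add: B_def)
qed

lemma open_cyl_domain: "open I \<Longrightarrow> open (cyl_domain I)"
  using open_vimage_vec_nth[of I "1::2"] by (simp add: cyl_domain_def vimage_def)

text \<open>The agreement of \<open>f\<close> with \<open>h\<close> is required only over \<open>I\<close>: the partial derivatives of a cylinder
  are meaningful only over the interval on which its base curve is differentiable.\<close>

lemma partial_of_first_coordinate:
  assumes "open I" "p \<in> cyl_domain I"
    and f: "\<And>q. q \<in> cyl_domain I \<Longrightarrow> f q = h (q $ 1)"
    and h: "(h has_vector_derivative h') (at (p $ 1))"
  shows "partial 1 f p = h'" "partial 2 f p = 0"
proof -
  have "((\<lambda>q::real^2. q $ 1) has_derivative (\<lambda>q. q $ 1)) (at p)"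
    by (intro bounded_linear_imp_has_derivative bounded_linear_vec_nth)
  from has_derivative_compose[OF this h[unfolded has_vector_derivative_def]]
  have "((\<lambda>q. h (q $ 1)) has_derivative (\<lambda>q. (q $ 1) *\<^sub>R h')) (at p)" .
  then have "(f has_derivative (\<lambda>q. (q $ 1) *\<^sub>R h')) (at p)"
    by (rule has_derivative_transform_within_open[OF _ open_cyl_domain[OF assms(1)] assms(2)])
      (simp add: f)
  then have *: "frechet_derivative f (at p) = (\<lambda>q. (q $ 1) *\<^sub>R h')"
    by (rule frechet_derivative_at[symmetric])
  show "partial 1 f p = h'" "partial 2 f p = 0"
    by (simp_all add: partial_def * axis_def)
qed

lemma C2_curve_derivatives:
  assumes "C2_curve \<gamma> I" "s \<in> I"
  shows "(\<gamma> has_vector_derivative vector_derivative \<gamma> (at s)) (at s)"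
    and "((\<lambda>r. vector_derivative \<gamma> (at r)) has_vector_derivative
          vector_derivative (\<lambda>r. vector_derivative \<gamma> (at r)) (at s)) (at s)"
  using assms by (simp_all add: C2_curve_def vector_derivative_works[symmetric])

lemma partial_cyl:
  assumes "open I" "C2_curve \<gamma> I" "p \<in> cyl_domain I"
  shows "partial 1 (cyl \<gamma> w) p = vector_derivative \<gamma> (at (p $ 1))"
    and "partial 2 (cyl \<gamma> w) p = w"
proof -
  have s: "p $ 1 \<in> I"
    using assms by (simp add: cyl_domain_def)
  have c: "((\<lambda>q::real^2. q $ i) has_derivative (\<lambda>q. q $ i)) (at p)" for i
    by (intro bounded_linear_imp_has_derivative bounded_linear_vec_nth)
  have "(cyl \<gamma> w has_derivative
      (\<lambda>q. (q $ 1) *\<^sub>R vector_derivative \<gamma> (at (p $ 1)) + (q $ 2) *\<^sub>R w)) (at p)"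
    unfolding cyl_def[abs_def]
    using C2_curve_derivatives(1)[OF assms(2) s, unfolded has_vector_derivative_def]
    by (intro has_derivative_add has_derivative_compose[OF c] has_derivative_scaleR_left c)
  then have *: "frechet_derivative (cyl \<gamma> w) (at p) =
      (\<lambda>q. (q $ 1) *\<^sub>R vector_derivative \<gamma> (at (p $ 1)) + (q $ 2) *\<^sub>R w)"
    by (rule frechet_derivative_at[symmetric])
  show "partial 1 (cyl \<gamma> w) p = vector_derivative \<gamma> (at (p $ 1))"
    "partial 2 (cyl \<gamma> w) p = w"
    by (simp_all add: partial_def * axis_def)
qed

lemma second_partial_cyl:
  assumes "open I" "C2_curve \<gamma> I" "p \<in> cyl_domain I"
  shows "partial 1 (partial 1 (cyl \<gamma> w)) p =
      vector_derivative (\<lambda>r. vector_derivative \<gamma> (at r)) (at (p $ 1))"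
    and "partial 1 (partial 2 (cyl \<gamma> w)) p = 0"
    and "partial 2 (partial i (cyl \<gamma> w)) p = 0"
proof -
  have s: "p $ 1 \<in> I"
    using assms by (simp add: cyl_domain_def)
  note A = partial_of_first_coordinate[OF assms(1,3) partial_cyl(1)[OF assms(1,2)]
      C2_curve_derivatives(2)[OF assms(2) s]]
  note B = partial_of_first_coordinate[OF assms(1,3) partial_cyl(2)[OF assms(1,2)]
      has_vector_derivative_const]
  show "partial 1 (partial 1 (cyl \<gamma> w)) p =
      vector_derivative (\<lambda>r. vector_derivative \<gamma> (at r)) (at (p $ 1))"
    by (rule A)
  show "partial 1 (partial 2 (cyl \<gamma> w)) p = 0"
    by (rule B)
  show "partial 2 (partial i (cyl \<gamma> w)) p = 0"
    using A(2) B(2) exhaust_2[of i] by auto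
qed

lemma partial_induced_metric_cyl:
  assumes "open I" "C2_curve \<gamma> I" "p \<in> cyl_domain I"
  shows "partial 2 (\<lambda>q. induced_metric (cyl \<gamma> w) q $ i $ j) p = 0"
    and "partial 1 (\<lambda>q. induced_metric (cyl \<gamma> w) q $ 2 $ 2) p = 0"
proof -
  have s: "p $ 1 \<in> I"
    using assms by (simp add: cyl_domain_def)
  define T where "T = (\<lambda>(i::2) r. if i = 1 then vector_derivative \<gamma> (at r) else w)"
  have T: "partial i (cyl \<gamma> w) q = T i (q $ 1)" if "q \<in> cyl_domain I" for i q
    using partial_cyl[OF assms(1,2) that, of w] exhaust_2[of i] by (auto simp: T_def)
  have "\<exists>T'. (T i has_vector_derivative T') (at (p $ 1))" for i
  proof (cases "i = 1")
    case True
    then show ?thesis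
      using C2_curve_derivatives(2)[OF assms(2) s] by (auto simp: T_def)
  next
    case False
    then show ?thesis
      using has_vector_derivative_const by (fastforce simp: T_def)
  qed
  then obtain T' where T': "\<And>i. (T i has_vector_derivative T' i) (at (p $ 1))"
    by metis
  have m: "induced_metric (cyl \<gamma> w) q $ i $ j = lorentz (T i (q $ 1)) (T j (q $ 1))"
    if "q \<in> cyl_domain I" for i j q
    using T[OF that] by (simp add: induced_metric_def)
  show "partial 2 (\<lambda>q. induced_metric (cyl \<gamma> w) q $ i $ j) p = 0"
    by (rule partial_of_first_coordinate(2)[OF assms(1,3),
          where h = "\<lambda>r. lorentz (T i r) (T j r)"])
      (use m bounded_bilinear.has_vector_derivative[OF bounded_bilinear_lorentz T' T'] in auto)
  show "partial 1 (\<lambda>q. induced_metric (cyl \<gamma> w) q $ 2 $ 2) p = 0"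
    by (rule partial_of_first_coordinate(1)[OF assms(1,3), where h = "\<lambda>r. lorentz w w"])
      (simp_all add: m T_def has_vector_derivative_const)
qed

text \<open>The mixed second derivatives of the parametrization vanish, and so do the corresponding Christoffel
  symbols: they involve only \<open>t\<close>-derivatives of the metric, derivatives of the constant
  \<open>lorentz w w\<close>, and the two terms \<open>\<partial>\<^sub>s g\<^sub>2\<^sub>1 - \<partial>\<^sub>s g\<^sub>1\<^sub>2\<close>, which cancel.\<close>

lemma second_fundamental_form_cyl_ruling:
  assumes "open I" "C2_curve \<gamma> I" "p \<in> cyl_domain I" "i = 2 \<or> j = 2"
  shows "second_fundamental_form (cyl \<gamma> w) i j p = 0"
proof -
  have sym: "(\<lambda>q. induced_metric (cyl \<gamma> w) q $ 2 $ 1) = (\<lambda>q. induced_metric (cyl \<gamma> w) q $ 1 $ 2)"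
    by (simp add: induced_metric_def lorentz_commute)
  have "christoffel (cyl \<gamma> w) k i j p = 0" for k
    using assms(4) exhaust_2[of i] exhaust_2[of j]
    by (auto simp: christoffel_def sum_2 partial_induced_metric_cyl[OF assms(1-3)] sym)
  moreover have "partial i (partial j (cyl \<gamma> w)) p = 0"
    using assms(4) exhaust_2[of i] second_partial_cyl[OF assms(1-3)] by auto
  ultimately show ?thesis
    by (simp add: second_fundamental_form_def)
qed

lemma mean_curvature_vector_cyl:
  assumes "open I" "C2_curve \<gamma> I" "p \<in> cyl_domain I"
  shows "2 *\<^sub>R mean_curvature_vector (cyl \<gamma> w) p =
    matrix_inv (induced_metric (cyl \<gamma> w) p) $ 1 $ 1 *\<^sub>R second_fundamental_form (cyl \<gamma> w) 1 1 p"
  by (simp add: mean_curvature_vector_def sum_2 second_fundamental_form_cyl_ruling[OF assms])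

lemma det_induced_metric_cyl:
  assumes "open I" "C2_curve \<gamma> I" "p \<in> cyl_domain I"
  defines "d \<equiv> vector_derivative \<gamma> (at (p $ 1))"
  shows "det (induced_metric (cyl \<gamma> w) p) =
    lorentz d d * lorentz w w - lorentz d w * lorentz d w"
  using partial_cyl[OF assms(1-3), of w]
  by (simp add: det_2 induced_metric_def d_def lorentz_commute)

text \<open>Multiplying by the determinant keeps the formula meaningful for lightlike rulings, where it says that
  the mean curvature vanishes.\<close>

lemma det_times_mean_curvature_cyl:
  assumes "open I" "C2_curve \<gamma> I" "p \<in> cyl_domain I"
    and "det (induced_metric (cyl \<gamma> w) p) \<noteq> 0"
  shows "(2 * det (induced_metric (cyl \<gamma> w) p)) *\<^sub>R mean_curvature_vector (cyl \<gamma> w) p =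
    lorentz w w *\<^sub>R second_fundamental_form (cyl \<gamma> w) 1 1 p"
proof -
  let ?g = "induced_metric (cyl \<gamma> w) p"
  have "(2 * det ?g) *\<^sub>R mean_curvature_vector (cyl \<gamma> w) p =
      det ?g *\<^sub>R (2 *\<^sub>R mean_curvature_vector (cyl \<gamma> w) p)"
    by simp
  also have "\<dots> = (det ?g * matrix_inv ?g $ 1 $ 1) *\<^sub>R second_fundamental_form (cyl \<gamma> w) 1 1 p"
    by (simp only: mean_curvature_vector_cyl[OF assms(1-3)] scaleR_scaleR)
  also have "det ?g * matrix_inv ?g $ 1 $ 1 = lorentz w w"
    using matrix_inv_2_11[OF assms(4)] partial_cyl(2)[OF assms(1-3), of w]
    by (simp add: induced_metric_def)
  finally show ?thesis .
qed

text \<open>The pairing of the mean curvature vector with the normal kills the Christoffel terms of the second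
  fundamental form, so the acceleration of the base curve is the only second-order quantity left.\<close>

lemma soliton_cyl_equation:
  assumes "open I" "C2_curve \<gamma> I" "translating_soliton (cyl \<gamma> w) (cyl_domain I) v" "s \<in> I"
  defines "d \<equiv> vector_derivative \<gamma> (at s)"
    and "d2 \<equiv> vector_derivative (\<lambda>r. vector_derivative \<gamma> (at r)) (at s)"
  defines "D \<equiv> lorentz d d * lorentz w w - lorentz d w * lorentz d w"
  obtains n where "lorentz n n \<in> {-1, 1}" "lorentz n d = 0" "lorentz n w = 0"
    "D \<noteq> 0" "D * lorentz n n * lorentz n v = lorentz w w * lorentz n d2"
proof -
  define p :: "real^2" where "p = axis 1 s"
  have p: "p \<in> cyl_domain I" "p $ 1 = s"
    using assms(4) by (simp_all add: p_def cyl_domain_def)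
  let ?H = "mean_curvature_vector (cyl \<gamma> w) p"
  obtain N h where N: "lorentz (N p) (N p) \<in> {-1, 1}"
    "\<And>i. lorentz (N p) (partial i (cyl \<gamma> w) p) = 0"
    and h: "?H = h *\<^sub>R N p" "2 * h = lorentz (N p) v"
    using assms(3) p(1) unfolding translating_soliton_def unit_normal_field_def by metis
  have det: "det (induced_metric (cyl \<gamma> w) p) = D"
    using det_induced_metric_cyl[OF assms(1,2) p(1)] p(2) by (simp add: D_def d_def)
  have D: "D \<noteq> 0"
    using assms(3) p(1) det by (auto simp: translating_soliton_def nondegenerate_surface_def)
  have orth: "lorentz (N p) d = 0" "lorentz (N p) w = 0"
    using N(2)[of 1] N(2)[of 2] partial_cyl[OF assms(1,2) p(1), of w] p(2)
    by (simp_all add: d_def)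
  interpret L: bounded_bilinear lorentz
    by (rule bounded_bilinear_lorentz)
  have "lorentz (N p) ((2 * D) *\<^sub>R ?H) = D * lorentz (N p) (N p) * (2 * h)"
    by (simp add: h(1) L.scaleR_right)
  moreover have "lorentz (N p) ((2 * D) *\<^sub>R ?H) =
      lorentz w w * lorentz (N p) (second_fundamental_form (cyl \<gamma> w) 1 1 p)"
    using det_times_mean_curvature_cyl[OF assms(1,2) p(1), of w] D
    unfolding det by (simp only: L.scaleR_right not_False_eq_True simp_thms real_scaleR_def)
  moreover have "lorentz (N p) (second_fundamental_form (cyl \<gamma> w) 1 1 p) = lorentz (N p) d2"
    using second_partial_cyl(1)[OF assms(1,2) p(1), of w] p(2) N(2)
    by (simp add: second_fundamental_form_def sum_2 L.diff_right L.add_right L.scaleR_right d2_def)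
  ultimately have "D * lorentz (N p) (N p) * lorentz (N p) v = lorentz w w * lorentz (N p) d2"
    by (simp add: h(2))
  then show thesis
    using that[OF N(1) orth D] by blast
qed

section \<open>Accumulation of vertical points\<close>

text \<open>Gronwall's argument: with \<open>\<bar>k\<bar> \<le> C\<close>, the function \<open>a\<^sup>2 * exp (- 2 * C * r)\<close> is nonincreasing and
  \<open>a\<^sup>2 * exp (2 * C * r)\<close> is nondecreasing; both are nonnegative and vanish at \<open>s0\<close>.\<close>

lemma linear_ode_zero:
  fixes a k :: "real \<Rightarrow> real"
  assumes S: "is_interval S" "s0 \<in> S" "s \<in> S"
    and a: "\<And>r. r \<in> S \<Longrightarrow> (a has_real_derivative k r * a r) (at r)"
    and k: "\<And>r. r \<in> S \<Longrightarrow> \<bar>k r\<bar> \<le> C"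
    and 0: "a s0 = 0"
  shows "a s = 0"
proof -
  have d: "((\<lambda>r. (a r)\<^sup>2 * exp (c * r)) has_real_derivative
      (2 * k r + c) * ((a r)\<^sup>2 * exp (c * r))) (at r)" if "r \<in> S" for c r
    using a[OF that] by (auto intro!: derivative_eq_intros simp: power2_eq_square algebra_simps)
  show ?thesis
  proof (cases "s0 \<le> s")
    case True
    have "(a s)\<^sup>2 * exp (-2 * C * s) \<le> (a s0)\<^sup>2 * exp (-2 * C * s0)"
    proof (rule DERIV_nonpos_imp_nonincreasing[OF True])
      fix r assume "s0 \<le> r" "r \<le> s"
      then have r: "r \<in> S"
        using S mem_is_interval_1_I by blast
      have "(2 * k r + -2 * C) * ((a r)\<^sup>2 * exp (-2 * C * r)) \<le> 0"
        using k[OF r] by (intro mult_nonpos_nonneg) auto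
      then show "\<exists>y. ((\<lambda>r. (a r)\<^sup>2 * exp (-2 * C * r)) has_real_derivative y) (at r) \<and> y \<le> 0"
        using d[OF r] by blast
    qed
    then show ?thesis
      by (simp add: 0 mult_le_0_iff)
  next
    case False
    then have le: "s \<le> s0"
      by simp
    have "(a s)\<^sup>2 * exp (2 * C * s) \<le> (a s0)\<^sup>2 * exp (2 * C * s0)"
    proof (rule DERIV_nonneg_imp_nondecreasing[OF le])
      fix r assume "s \<le> r" "r \<le> s0"
      then have r: "r \<in> S"
        using S mem_is_interval_1_I by blast
      have "(2 * k r + 2 * C) * ((a r)\<^sup>2 * exp (2 * C * r)) \<ge> 0"
        using k[OF r] by (intro mult_nonneg_nonneg) auto
      then show "\<exists>y. ((\<lambda>r. (a r)\<^sup>2 * exp (2 * C * r)) has_real_derivative y) (at r) \<and> 0 \<le> y"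
        using d[OF r] by blast
    qed
    then show ?thesis
      by (simp add: 0 mult_le_0_iff)
  qed
qed

text \<open>Along the accumulating zeros both the function and its difference quotient at the limit vanish.\<close>

lemma accumulating_zeros:
  fixes f :: "real \<Rightarrow> real"
  assumes lim: "s0 islimpt {s \<in> I. f s = 0}" and f: "(f has_real_derivative f') (at s0)"
  shows "f s0 = 0" "f' = 0"
proof -
  let ?F = "at s0 within {s \<in> I. f s = 0}"
  have nt: "?F \<noteq> bot"
    using lim by (simp add: trivial_limit_within)
  have ev: "\<forall>\<^sub>F s in ?F. f s = 0"
    by (simp add: eventually_at_filter)
  have "(f \<longlongrightarrow> f s0) ?F"
    using DERIV_isCont[OF f] by (metis continuous_at_imp_continuous_at_within continuous_within)
  moreover have "(f \<longlongrightarrow> 0) ?F"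
    using ev by (rule tendsto_eventually)
  ultimately show f0: "f s0 = 0"
    using nt tendsto_unique by blast
  have "((\<lambda>s. (f s - f s0) / (s - s0)) \<longlongrightarrow> f') ?F"
    using has_field_derivative_at_within[OF f] by (simp add: has_field_derivative_iff)
  moreover have "((\<lambda>s. (f s - f s0) / (s - s0)) \<longlongrightarrow> 0) ?F"
    using ev f0 by (intro tendsto_eventually) (auto elim: eventually_mono)
  ultimately show "f' = 0"
    using nt tendsto_unique by blast
qed

text \<open>At an accumulation point of zeros of \<open>a\<close> both \<open>a\<close> and \<open>a'\<close> vanish while \<open>b\<close> does not, so the
  equation forces \<open>e = 0\<close>. After that it reads \<open>a' = k * a\<close> with \<open>k = (b' - W * c) / b\<close> near every zero
  of \<open>a\<close>, so the zero set is open as well as closed in the interval.\<close>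

lemma accumulating_vertical_points_imp_all:
  fixes a b a' b' W :: "real \<Rightarrow> real" and c e :: real
  assumes I: "open_interval I"
    and a: "\<And>s. s \<in> I \<Longrightarrow> (a has_real_derivative a' s) (at s)"
    and b: "\<And>s. s \<in> I \<Longrightarrow> (b has_real_derivative b' s) (at s)"
    and cont: "continuous_on I b'" "continuous_on I W"
    and eq: "\<And>s. s \<in> I \<Longrightarrow> a s * b' s - a' s * b s = W s * (c * a s + e * b s)"
    and W: "\<And>s. s \<in> I \<Longrightarrow> W s \<noteq> 0"
    and reg: "\<And>s. s \<in> I \<Longrightarrow> a s = 0 \<Longrightarrow> b s \<noteq> 0"
    and s0: "s0 \<in> I" "s0 islimpt {s \<in> I. a s = 0}"
  shows "e = 0" "\<forall>s\<in>I. a s = 0"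
proof -
  have z: "a s0 = 0" "a' s0 = 0"
    using accumulating_zeros[OF s0(2) a[OF s0(1)]] by auto
  show e: "e = 0"
    using eq[OF s0(1)] W[OF s0(1)] reg[OF s0(1) z(1)] z by simp
  let ?Z = "{s \<in> I. a s = 0}"
  have ca: "continuous_on I a" and cb: "continuous_on I b"
    using a b by (meson DERIV_isCont continuous_at_imp_continuous_on)+
  have "open I" "is_interval I"
    using I by (auto simp: open_interval_def)
  have "open ?Z"
  proof (rule openI)
    fix s assume s: "s \<in> ?Z"
    have "open (I \<inter> b -` (- {0}))"
      using cb \<open>open I\<close> by (intro continuous_open_preimage) auto
    moreover have "s \<in> I \<inter> b -` (- {0})"
      using s reg by auto
    ultimately obtain d where d: "d > 0" "cball s d \<subseteq> I \<inter> b -` (- {0})"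
      using open_contains_cball by blast
    \<comment> \<open>A closed ball, so that compactness bounds the coefficient \<open>k\<close>.\<close>
    define k where "k = (\<lambda>r. (b' r - W r * c) / b r)"
    have "continuous_on (cball s d) k"
      unfolding k_def using d(2)
      by (intro continuous_intros continuous_on_subset[OF cont(1)] continuous_on_subset[OF cont(2)]
          continuous_on_subset[OF cb]) auto
    then have "bounded (k ` cball s d)"
      using compact_cball compact_continuous_image compact_imp_bounded by blast
    then obtain C where C: "\<And>r. r \<in> cball s d \<Longrightarrow> \<bar>k r\<bar> \<le> C"
      unfolding bounded_iff by (metis imageI real_norm_def)
    have der: "(a has_real_derivative k r * a r) (at r)" if "r \<in> cball s d" for r
    proof -
      have r: "r \<in> I" "b r \<noteq> 0"
        using that d(2) by auto
      have "a' r * b r = (b' r - W r * c) * a r"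
        using eq[OF r(1)] e by (simp add: algebra_simps)
      then have "a' r = k r * a r"
        using r(2) by (simp add: k_def field_simps)
      then show ?thesis
        using a[OF r(1)] by simp
    qed
    have "is_interval (cball s d)"
      by (rule is_interval_cball_1)
    then have "a r = 0" if "r \<in> cball s d" for r
      using linear_ode_zero[of "cball s d" s r a k C] that der C s d(1) by auto
    then have "ball s d \<subseteq> ?Z"
      using d(2) by auto
    then show "\<exists>\<epsilon>>0. ball s \<epsilon> \<subseteq> ?Z"
      using d(1) by blast
  qed
  then have "openin (top_of_set I) ?Z"
    by (simp add: open_subset)
  moreover have "closedin (top_of_set I) ?Z"
    by (rule continuous_closedin_preimage_constant[OF ca])
  moreover have "connected I"
    using \<open>is_interval I\<close> by (simp add: is_interval_connected_1)
  moreover have "s0 \<in> ?Z"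
    using s0 z by simp
  ultimately have "?Z = I"
    unfolding connected_clopen by blast
  then show "\<forall>s\<in>I. a s = 0"
    by blast
qed

section \<open>Graphs and planes\<close>

lemma nonzero_derivative_on_interval:
  fixes x a :: "real \<Rightarrow> real"
  assumes J: "open_interval J"
    and x: "\<And>s. s \<in> J \<Longrightarrow> (x has_real_derivative a s) (at s)"
    and a: "\<And>s. s \<in> J \<Longrightarrow> a s \<noteq> 0"
  shows "inj_on x J" "open_interval (x ` J)"
    "s \<in> J \<Longrightarrow> (the_inv_into J x has_real_derivative inverse (a s)) (at (x s))"
proof -
  have J': "open J" "is_interval J" "J \<noteq> {}"
    using J by (auto simp: open_interval_def)
  have cx: "continuous_on J x"
    using x by (meson DERIV_isCont continuous_at_imp_continuous_on)
  have "x s \<noteq> x t" if "s \<in> J" "t \<in> J" "s < t" for s t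
  proof
    assume "x s = x t"
    have "r \<in> J" if "s \<le> r" "r \<le> t" for r
      using that \<open>s \<in> J\<close> \<open>t \<in> J\<close> J'(2) mem_is_interval_1_I by blast
    then obtain z where "s < z" "z < t" "x t - x s = (t - s) * a z" "z \<in> J"
      using MVT2[OF \<open>s < t\<close>, of x a] x by (metis less_imp_le)
    then show False
      using \<open>x s = x t\<close> \<open>s < t\<close> a by auto
  qed
  then show inj: "inj_on x J"
    by (metis inj_onI linorder_neqE_linordered_idom)
  show "open_interval (x ` J)"
    unfolding open_interval_def
    using J' injective_into_1d_imp_open_map_UNIV[OF J'(1) cx inj]
      connected_continuous_image[OF cx] by (auto simp: is_interval_connected_1)
  show "(the_inv_into J x has_real_derivative inverse (a s)) (at (x s))" if s: "s \<in> J"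
    unfolding has_field_derivative_def
    by (rule has_derivative_inverse_strong[OF J'(1) s cx the_inv_into_f_f[OF inj]
          x[OF s, unfolded has_field_derivative_def]])
      (use a[OF s] in \<open>auto simp: fun_eq_iff\<close>)
qed

text \<open>The curve \<open>(x, y)\<close> is the graph of \<open>u = y \<circ> x\<inverse>\<close>; the derivatives of \<open>u\<close> come from the chain rule and
  the inverse function theorem.\<close>

lemma graph_reparametrization:
  fixes x y a b a' b' :: "real \<Rightarrow> real"
  assumes J: "open_interval J"
    and x: "\<And>s. s \<in> J \<Longrightarrow> (x has_real_derivative a s) (at s)"
    and y: "\<And>s. s \<in> J \<Longrightarrow> (y has_real_derivative b s) (at s)"
    and a: "\<And>s. s \<in> J \<Longrightarrow> (a has_real_derivative a' s) (at s)"
    and b: "\<And>s. s \<in> J \<Longrightarrow> (b has_real_derivative b' s) (at s)"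
    and nz: "\<And>s. s \<in> J \<Longrightarrow> a s \<noteq> 0"
  obtains u where "open_interval (x ` J)"
    "\<And>s. s \<in> J \<Longrightarrow> u (x s) = y s"
    "\<And>s. s \<in> J \<Longrightarrow> u differentiable (at (x s))"
    "\<And>s. s \<in> J \<Longrightarrow> deriv u (x s) = b s / a s"
    "\<And>s. s \<in> J \<Longrightarrow> deriv u differentiable (at (x s))"
    "\<And>s. s \<in> J \<Longrightarrow> deriv (deriv u) (x s) = (a s * b' s - a' s * b s) / (a s)^3"
proof -
  note D = nonzero_derivative_on_interval[OF J x nz]
  let ?g = "the_inv_into J x"
  have g: "?g (x s) = s" if "s \<in> J" for s
    using D(1) that by (rule the_inv_into_f_f)
  have comp: "((\<lambda>r. f (?g r)) has_real_derivative f' / a s) (at (x s))"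
    if "s \<in> J" "(f has_real_derivative f') (at s)" for f f' s
    using DERIV_chain2[of f f' ?g "x s", OF _ D(3)] that g by (simp add: divide_inverse)
  let ?u = "\<lambda>r. y (?g r)"
  have u: "(?u has_real_derivative b s / a s) (at (x s))" if "s \<in> J" for s
    using comp[OF that y[OF that]] .
  then have du: "deriv ?u (x s) = b s / a s" if "s \<in> J" for s
    using that by (blast intro: DERIV_imp_deriv)
  have ddu: "(deriv ?u has_real_derivative (a s * b' s - a' s * b s) / (a s)^3) (at (x s))"
    if s: "s \<in> J" for s
  proof (rule has_field_derivative_transform_within_open)
    have "((\<lambda>r. b r / a r) has_real_derivative (b' s * a s - b s * a' s) / (a s * a s)) (at s)"
      by (rule DERIV_divide[OF b[OF s] a[OF s] nz[OF s]])
    from comp[OF s this]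
    show "((\<lambda>r. b (?g r) / a (?g r)) has_real_derivative (a s * b' s - a' s * b s) / (a s)^3)
        (at (x s))"
      by (simp add: power3_eq_cube mult.commute)
    show "open (x ` J)"
      using D(2) by (simp add: open_interval_def)
    show "x s \<in> x ` J"
      using s by simp
    show "b (?g r) / a (?g r) = deriv ?u r" if "r \<in> x ` J" for r
      using that du g by auto
  qed
  show thesis
  proof (rule that[of ?u])
    show "open_interval (x ` J)"
      by (rule D(2))
    show "?u differentiable at (x s)" if "s \<in> J" for s
      using u[OF that] real_differentiable_def by blast
    show "deriv ?u differentiable at (x s)" if "s \<in> J" for s
      using ddu[OF that] real_differentiable_def by blast
    show "deriv (deriv ?u) (x s) = (a s * b' s - a' s * b s) / (a s)^3" if "s \<in> J" for s
      using ddu[OF that] by (rule DERIV_imp_deriv)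
  qed (simp_all add: g du)
qed

lemma C2_curve_component:
  assumes "C2_curve \<gamma> I" "s \<in> I"
  defines "\<gamma>' \<equiv> \<lambda>s. vector_derivative \<gamma> (at s)"
  shows "((\<lambda>s. \<gamma> s $ i) has_real_derivative \<gamma>' s $ i) (at s)"
    and "((\<lambda>s. \<gamma>' s $ i) has_real_derivative vector_derivative \<gamma>' (at s) $ i) (at s)"
  using C2_curve_derivatives[OF assms(1,2)] unfolding \<gamma>'_def
  by (auto intro: bounded_linear.has_vector_derivative[OF bounded_linear_vec_nth]
      simp: has_real_derivative_iff_has_vector_derivative)

lemma cyl_image: "cyl \<gamma> w ` cyl_domain I = {\<gamma> s + t *\<^sub>R w | s t. s \<in> I}"
proof -
  have "\<gamma> s + t *\<^sub>R w \<in> cyl \<gamma> w ` cyl_domain I" if "s \<in> I" for s t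
  proof (rule image_eqI)
    show "\<gamma> s + t *\<^sub>R w = cyl \<gamma> w (\<chi> i. if i = 1 then s else t)"
      by (simp add: cyl_def)
    show "(\<chi> i::2. if i = 1 then s else t) \<in> cyl_domain I"
      using that by (simp add: cyl_domain_def)
  qed
  then show ?thesis
    by (auto simp: cyl_def cyl_domain_def)
qed

text \<open>The common part of the spacelike and the timelike case. The indices \<open>i\<close> and \<open>j\<close> are the two
  coordinates in the plane of the base curve, \<open>i\<close> the one to be used as parameter. The hypothesis on
  \<open>ode\<close> is the algebraic translation of the equation along the curve into slope and second derivative
  of the graph.\<close>

lemma parametrizes_as_graph_or_all_vertical:
  fixes \<gamma> \<gamma>' \<gamma>'' :: "real \<Rightarrow> real^3" and i j :: 3 and W :: "real \<Rightarrow> real" and c e :: real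
  assumes I: "open_interval I" and C2: "C2_curve \<gamma> I"
    and \<gamma>'_def: "\<gamma>' = (\<lambda>s. vector_derivative \<gamma> (at s))"
    and \<gamma>''_def: "\<gamma>'' = (\<lambda>s. vector_derivative \<gamma>' (at s))"
    and coords: "\<And>s. s \<in> I \<Longrightarrow> \<gamma> s = C (\<gamma> s $ i) (\<gamma> s $ j)"
    and W: "continuous_on I W" "\<And>s. s \<in> I \<Longrightarrow> W s \<noteq> 0"
    and eq: "\<And>s. s \<in> I \<Longrightarrow> \<gamma>' s $ i * \<gamma>'' s $ j - \<gamma>'' s $ i * \<gamma>' s $ j =
        W s * (c * \<gamma>' s $ i + e * \<gamma>' s $ j)"
    and reg: "\<And>s. s \<in> I \<Longrightarrow> \<gamma>' s $ i = 0 \<Longrightarrow> \<gamma>' s $ j \<noteq> 0"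
    and ode: "\<And>s. s \<in> I \<Longrightarrow> \<gamma>' s $ i \<noteq> 0 \<Longrightarrow> ode (\<gamma>' s $ j / \<gamma>' s $ i)
        (W s * (c * \<gamma>' s $ i + e * \<gamma>' s $ j) / (\<gamma>' s $ i)^3)"
  shows "e = 0 \<and> (\<forall>s\<in>I. \<gamma>' s $ i = 0) \<or> parametrizes_as_graph i C ode \<gamma> w I"
proof (cases "\<exists>s\<in>I. s islimpt vertical_points i \<gamma> I")
  case True
  then obtain s0 where s0: "s0 \<in> I" "s0 islimpt {s \<in> I. \<gamma>' s $ i = 0}"
    unfolding vertical_points_def \<gamma>'_def by blast
  have "continuous_on I (\<lambda>s. \<gamma>'' s $ j)"
    using C2 unfolding C2_curve_def \<gamma>''_def \<gamma>'_def by (intro continuous_intros) auto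
  then show ?thesis
    using accumulating_vertical_points_imp_all[OF I, of "\<lambda>s. \<gamma>' s $ i" "\<lambda>s. \<gamma>'' s $ i"
        "\<lambda>s. \<gamma>' s $ j" "\<lambda>s. \<gamma>'' s $ j" W c e s0] C2_curve_component(2)[OF C2] W eq reg s0
    unfolding \<gamma>''_def \<gamma>'_def by blast
next
  case False
  have "\<exists>K u. open_interval K \<and>
           cyl \<gamma> w ` cyl_domain J = cyl (\<lambda>s. C s (u s)) w ` cyl_domain K \<and>
           (\<forall>s\<in>K. u differentiable (at s) \<and> deriv u differentiable (at s) \<and>
                  ode (deriv u s) (deriv (deriv u) s))"
    if J: "open_interval J" "J \<subseteq> I - vertical_points i \<gamma> I" for J
  proof -
    have JI: "s \<in> I" and nz: "\<gamma>' s $ i \<noteq> 0" if "s \<in> J" for s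
      using J(2) that by (auto simp: vertical_points_def \<gamma>'_def)
    obtain u where u: "open_interval ((\<lambda>s. \<gamma> s $ i) ` J)"
      "\<And>s. s \<in> J \<Longrightarrow> u (\<gamma> s $ i) = \<gamma> s $ j"
      "\<And>s. s \<in> J \<Longrightarrow> u differentiable (at (\<gamma> s $ i))"
      "\<And>s. s \<in> J \<Longrightarrow> deriv u (\<gamma> s $ i) = \<gamma>' s $ j / \<gamma>' s $ i"
      "\<And>s. s \<in> J \<Longrightarrow> deriv u differentiable (at (\<gamma> s $ i))"
      "\<And>s. s \<in> J \<Longrightarrow> deriv (deriv u) (\<gamma> s $ i) =
        (\<gamma>' s $ i * \<gamma>'' s $ j - \<gamma>'' s $ i * \<gamma>' s $ j) / (\<gamma>' s $ i)^3"
      using graph_reparametrization[OF J(1), of "\<lambda>s. \<gamma> s $ i" "\<lambda>s. \<gamma>' s $ i" "\<lambda>s. \<gamma> s $ j"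
          "\<lambda>s. \<gamma>' s $ j" "\<lambda>s. \<gamma>'' s $ i" "\<lambda>s. \<gamma>'' s $ j"]
        C2_curve_component[OF C2 JI] nz
      unfolding \<gamma>''_def \<gamma>'_def by blast
    have pt: "\<gamma> s = C (\<gamma> s $ i) (u (\<gamma> s $ i))" if "s \<in> J" for s
      using coords[OF JI[OF that]] u(2)[OF that] by simp
    have "cyl \<gamma> w ` cyl_domain J = cyl (\<lambda>s. C s (u s)) w ` cyl_domain ((\<lambda>s. \<gamma> s $ i) ` J)"
    proof -
      have "{C x (u x) + t *\<^sub>R w | x t. x \<in> (\<lambda>s. \<gamma> s $ i) ` J} =
          {C (\<gamma> s $ i) (u (\<gamma> s $ i)) + t *\<^sub>R w | s t. s \<in> J}"
        by blast
      also have "\<dots> = {\<gamma> s + t *\<^sub>R w | s t. s \<in> J}"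
        by (rule Collect_cong) (metis pt)
      finally show ?thesis
        unfolding cyl_image by (rule sym)
    qed
    moreover have "ode (deriv u (\<gamma> s $ i)) (deriv (deriv u) (\<gamma> s $ i))" if "s \<in> J" for s
      unfolding u(4,6)[OF that] eq[OF JI[OF that]] by (rule ode[OF JI[OF that] nz[OF that]])
    ultimately show ?thesis
      using u(1,3,5) by (intro exI[of _ "(\<lambda>s. \<gamma> s $ i) ` J"] exI[of _ u]) blast
  qed
  then have "\<forall>J. open_interval J \<and> J \<subseteq> I - vertical_points i \<gamma> I \<longrightarrow>
      (\<exists>K u. open_interval K \<and>
           cyl \<gamma> w ` cyl_domain J = cyl (\<lambda>s. C s (u s)) w ` cyl_domain K \<and>
           (\<forall>s\<in>K. u differentiable (at s) \<and> deriv u differentiable (at s) \<and>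
                  ode (deriv u s) (deriv (deriv u) s)))"
    by (intro allI impI) (elim conjE)
  moreover have "\<forall>s\<in>I. \<not> s islimpt vertical_points i \<gamma> I"
    using False by blast
  ultimately show ?thesis
    unfolding parametrizes_as_graph_def by (intro disjI2 conjI)
qed

text \<open>The plane is the level set of \<open>inner m\<close> through the surface. The functional \<open>inner f\<close> is constant on
  the rulings and strictly monotone along the base curve; by the kernel condition a point of the plane
  lies on the surface as soon as its value under \<open>inner f\<close> is attained on the base curve. These
  values form an open interval, so the surface is open in the plane.\<close>

lemma cylinder_in_plane:
  fixes \<gamma> :: "real \<Rightarrow> real^3" and m f v w :: "real^3"
  assumes I: "open_interval I" and C2: "C2_curve \<gamma> I"
    and m: "m \<noteq> 0" "inner m w = 0" "inner m v = 0"
      "\<And>s. s \<in> I \<Longrightarrow> inner m (vector_derivative \<gamma> (at s)) = 0"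
    and f: "inner f w = 0" "\<And>s. s \<in> I \<Longrightarrow> inner f (vector_derivative \<gamma> (at s)) \<noteq> 0"
    and ker: "\<And>y. inner m y = 0 \<Longrightarrow> inner f y = 0 \<Longrightarrow> \<exists>t. y = t *\<^sub>R w"
  shows "plane_parallel_to (cyl \<gamma> w ` cyl_domain I) v"
proof -
  have I': "open I" "is_interval I"
    using I by (auto simp: open_interval_def)
  have der: "((\<lambda>s. inner l (\<gamma> s)) has_real_derivative inner l (vector_derivative \<gamma> (at s))) (at s)"
    if "s \<in> I" for l s
    unfolding has_real_derivative_iff_has_vector_derivative
    by (intro bounded_linear.has_vector_derivative[OF bounded_linear_inner_right]
        C2_curve_derivatives(1)[OF C2 that])
  obtain r where r: "\<And>s. s \<in> I \<Longrightarrow> inner m (\<gamma> s) = r"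
    using has_field_derivative_zero_constant[of I "\<lambda>s. inner m (\<gamma> s)"] der[of _ m] m(4) I'(2)
    by (metis has_field_derivative_at_within is_interval_convex)
  define P where "P = {x. inner m x = r}"
  define U where "U = (\<lambda>s. inner f (\<gamma> s)) ` I"
  have "open U"
    using nonzero_derivative_on_interval(2)[OF I der f(2)] by (simp add: U_def open_interval_def)
  then have "open {x. inner f x \<in> U}"
    using continuous_open_preimage[of UNIV "inner f" U] by (simp add: vimage_def continuous_intros)
  moreover have "cyl \<gamma> w ` cyl_domain I = P \<inter> {x. inner f x \<in> U}"
  proof
    show "cyl \<gamma> w ` cyl_domain I \<subseteq> P \<inter> {x. inner f x \<in> U}"
      unfolding cyl_image by (auto simp: P_def U_def inner_add_right m f r)
    show "P \<inter> {x. inner f x \<in> U} \<subseteq> cyl \<gamma> w ` cyl_domain I"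
    proof
      fix x assume "x \<in> P \<inter> {x. inner f x \<in> U}"
      then obtain s where s: "s \<in> I" "inner f x = inner f (\<gamma> s)" "inner m x = inner m (\<gamma> s)"
        by (auto simp: P_def U_def r)
      then obtain t where "x - \<gamma> s = t *\<^sub>R w"
        using ker[of "x - \<gamma> s"] by (auto simp: inner_diff_right)
      then have "x = \<gamma> s + t *\<^sub>R w"
        by (simp add: algebra_simps)
      then show "x \<in> cyl \<gamma> w ` cyl_domain I"
        unfolding cyl_image using s(1) by blast
    qed
  qed
  ultimately have "openin (top_of_set P) (cyl \<gamma> w ` cyl_domain I)"
    by (metis openin_open_Int)
  moreover have "affine P" "aff_dim P = 2"
    using m(1) by (simp_all add: P_def affine_hyperplane aff_dim_hyperplane)
  moreover have "\<forall>x\<in>P. x + v \<in> P"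
    by (simp add: P_def inner_add_right m)
  ultimately show ?thesis
    unfolding plane_parallel_to_def by blast
qed


section \<open>The three types of rulings\<close>

lemma curve_in_span_annihilated:
  fixes \<gamma> :: "real \<Rightarrow> real^3"
  assumes "open I" "C2_curve \<gamma> I" "\<gamma> ` I \<subseteq> span B" "\<And>x. x \<in> B \<Longrightarrow> x $ i = 0" "s \<in> I"
  shows "\<gamma> s $ i = 0" "vector_derivative \<gamma> (at s) $ i = 0"
proof -
  have "span B \<subseteq> {x. x $ i = 0}"
    by (rule span_minimal) (use assms(4) in \<open>auto simp: subspace_def\<close>)
  then have *: "\<gamma> r $ i = 0" if "r \<in> I" for r
    using assms(3) that by blast
  then show "\<gamma> s $ i = 0"
    using assms(5) .
  have "((\<lambda>r. \<gamma> r $ i) has_real_derivative 0) (at s)"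
    by (rule has_field_derivative_transform_within_open[OF DERIV_const assms(1,5)]) (simp add: *)
  then show "vector_derivative \<gamma> (at s) $ i = 0"
    using C2_curve_component(1)[OF assms(2,5)] DERIV_unique by blast
qed

lemma cylinder_in_coordinate_plane:
  fixes \<gamma> :: "real \<Rightarrow> real^3" and i j k :: 3
  assumes "open_interval I" "C2_curve \<gamma> I"
    and "UNIV = {i, j, k}" "i \<noteq> k" "j \<noteq> k" "v $ i = 0"
    and "\<And>s. s \<in> I \<Longrightarrow> vector_derivative \<gamma> (at s) $ i = 0"
    and "\<And>s. s \<in> I \<Longrightarrow> vector_derivative \<gamma> (at s) $ j \<noteq> 0"
  shows "plane_parallel_to (cyl \<gamma> (axis k 1) ` cyl_domain I) v"
proof (rule cylinder_in_plane[OF assms(1,2), of "axis i 1" _ _ "axis j 1"])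
  fix y :: "real^3"
  assume "inner (axis i 1) y = 0" "inner (axis j 1) y = 0"
  then have "y $ i = 0" "y $ j = 0"
    by (simp_all add: inner_axis')
  then have "y $ l = (y $ k) * axis k 1 $ l" for l
    using UNIV_I[of l, unfolded assms(3)] assms(4,5) by (auto simp: axis_def)
  then have "y = (y $ k) *\<^sub>R axis k 1"
    unfolding vec_eq_iff vector_scaleR_component real_scaleR_def by blast
  then show "\<exists>t. y = t *\<^sub>R axis k 1" ..
next
  show "inner (axis i 1) (axis k 1 :: real^3) = 0" "inner (axis j 1) (axis k 1 :: real^3) = 0"
    using assms(4,5) by (simp_all add: inner_axis_axis)
qed (simp_all add: inner_axis' assms(6-8))

text \<open>Here \<open>(n2, n3)\<close> are the components of the unit normal and \<open>(a, b)\<close> those of the velocity of the base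
  curve in the Lorentzian \<open>yz\<close>-plane. Orthogonal non-null vectors of that plane have opposite causal character,
  so \<open>- \<epsilon>\<close> is the sign of \<open>a\<^sup>2 - b\<^sup>2\<close>; this produces the absolute value and, later, the two
  cases of the differential equation. Since \<open>(n2, n3)\<close> is proportional to \<open>(b, a)\<close>, multiplying the
  soliton equation by \<open>a\<close> or \<open>b\<close> exhibits a common factor \<open>n3\<close> or \<open>n2\<close>, and these do not both
  vanish.\<close>

lemma spacelike_rulings_normal_elimination:
  fixes a b a' b' n2 n3 v2 v3 :: real
  assumes n: "n2\<^sup>2 - n3\<^sup>2 = \<epsilon>" "\<epsilon> \<in> {-1, 1}" "n2 * a = n3 * b"
    and D: "a\<^sup>2 - b\<^sup>2 \<noteq> 0"
    and eq: "(a\<^sup>2 - b\<^sup>2) * \<epsilon> * (n2 * v2 - n3 * v3) = n2 * a' - n3 * b'"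
  shows "a * b' - a' * b = \<bar>a\<^sup>2 - b\<^sup>2\<bar> * (- v3 * a + v2 * b)"
proof -
  have "(n2\<^sup>2 + n3\<^sup>2) * (a\<^sup>2 - b\<^sup>2) = (n2\<^sup>2 * a\<^sup>2 - n3\<^sup>2 * b\<^sup>2) + n3\<^sup>2 * a\<^sup>2 - n2\<^sup>2 * b\<^sup>2"
    by (simp add: algebra_simps)
  also have "n2\<^sup>2 * a\<^sup>2 = n3\<^sup>2 * b\<^sup>2"
    using n(3) by (metis power_mult_distrib)
  finally have "(n2\<^sup>2 + n3\<^sup>2) * (a\<^sup>2 - b\<^sup>2) = n3\<^sup>2 * a\<^sup>2 - n2\<^sup>2 * b\<^sup>2"
    by simp
  also have "\<dots> = - \<epsilon> * (a\<^sup>2 + b\<^sup>2)"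
    using \<open>n2\<^sup>2 * a\<^sup>2 = n3\<^sup>2 * b\<^sup>2\<close> unfolding n(1)[symmetric] by (simp add: algebra_simps)
  finally have sgn: "(n2\<^sup>2 + n3\<^sup>2) * (a\<^sup>2 - b\<^sup>2) = - \<epsilon> * (a\<^sup>2 + b\<^sup>2)" .
  have pos: "n2\<^sup>2 + n3\<^sup>2 > 0" "a\<^sup>2 + b\<^sup>2 > 0"
    using n(1,2) D by (auto simp: sum_power2_gt_zero_iff)
  have "\<bar>a\<^sup>2 - b\<^sup>2\<bar> = - \<epsilon> * (a\<^sup>2 - b\<^sup>2)"
    using n(2)
  proof
    assume "\<epsilon> = -1"
    then have "0 < (n2\<^sup>2 + n3\<^sup>2) * (a\<^sup>2 - b\<^sup>2)"
      using sgn pos by simp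
    then show ?thesis
      using pos(1) \<open>\<epsilon> = -1\<close> by (simp add: zero_less_mult_iff)
  next
    assume "\<epsilon> \<in> {1}"
    then have "(n2\<^sup>2 + n3\<^sup>2) * (a\<^sup>2 - b\<^sup>2) < 0"
      using sgn pos by simp
    then show ?thesis
      using pos(1) \<open>\<epsilon> \<in> {1}\<close> by (simp add: mult_less_0_iff)
  qed
  define X where "X = a * b' - a' * b - (- \<epsilon> * (a\<^sup>2 - b\<^sup>2)) * (- v3 * a + v2 * b)"
  define Z where "Z = (a\<^sup>2 - b\<^sup>2) * \<epsilon> * (n2 * v2 - n3 * v3) - (n2 * a' - n3 * b')"
  have "n3 * X = a * Z + (n2 * a - n3 * b) * (a' - \<epsilon> * (a\<^sup>2 - b\<^sup>2) * v2)"
    "n2 * X = b * Z + (n2 * a - n3 * b) * (b' - \<epsilon> * (a\<^sup>2 - b\<^sup>2) * v3)"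
    unfolding X_def Z_def by (simp_all add: algebra_simps)
  then have "n3 * X = 0" "n2 * X = 0"
    using n(3) eq by (simp_all add: Z_def)
  then have "X = 0"
    using pos(1) by auto
  then show ?thesis
    using \<open>\<bar>a\<^sup>2 - b\<^sup>2\<bar> = - \<epsilon> * (a\<^sup>2 - b\<^sup>2)\<close> by (simp add: X_def)
qed

text \<open>The same elimination in the Euclidean \<open>xy\<close>-plane, where the unit normal is spacelike and no sign has
  to be determined.\<close>

lemma timelike_rulings_normal_elimination:
  fixes a b a' b' n1 n2 v1 v2 :: real
  assumes n: "n1\<^sup>2 + n2\<^sup>2 = 1" "n1 * a + n2 * b = 0"
    and eq: "(a\<^sup>2 + b\<^sup>2) * (n1 * v1 + n2 * v2) = n1 * a' + n2 * b'"
  shows "a * b' - a' * b = (a\<^sup>2 + b\<^sup>2) * (v2 * a + - v1 * b)"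
proof -
  define X where "X = a * b' - a' * b - (a\<^sup>2 + b\<^sup>2) * (v2 * a + - v1 * b)"
  define Z where "Z = n1 * a' + n2 * b' - (a\<^sup>2 + b\<^sup>2) * (n1 * v1 + n2 * v2)"
  have "n2 * X = a * Z + (n1 * a + n2 * b) * ((a\<^sup>2 + b\<^sup>2) * v1 - a')"
    "n1 * X = (n1 * a + n2 * b) * (b' - (a\<^sup>2 + b\<^sup>2) * v2) - b * Z"
    unfolding X_def Z_def by (simp_all add: algebra_simps)
  then have "n1 * X = 0" "n2 * X = 0"
    using n(2) eq by (simp_all add: Z_def)
  then have "X = 0"
    using n(1) by auto
  then show ?thesis
    by (simp add: X_def)
qed

lemma spacelike_rulings:
  fixes \<gamma> :: "real \<Rightarrow> real^3" and v w :: "real^3"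
  assumes I: "open_interval I" and C2: "C2_curve \<gamma> I"
    and w: "w = vector [1, 0, 0]" and \<gamma>: "\<gamma> ` I \<subseteq> span {vector [0, 1, 0], vector [0, 0, 1]}"
    and sol: "translating_soliton (cyl \<gamma> w) (cyl_domain I) v"
  shows "plane_parallel_to (cyl \<gamma> w ` cyl_domain I) v \<or>
    parametrizes_as_graph 2 (\<lambda>s y. vector [0, s, y])
        (\<lambda>u' u''. 1 - u'^2 \<noteq> 0 \<and>
          (1 - u'^2 > 0 \<longrightarrow> - u'' = - (1 - u'^2) * (v $ 2 * u' - v $ 3)) \<and>
          (1 - u'^2 < 0 \<longrightarrow> - u'' = (1 - u'^2) * (v $ 2 * u' - v $ 3)))
        \<gamma> w I"
proof -
  define d where "d = (\<lambda>s. vector_derivative \<gamma> (at s))"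
  define d2 where "d2 = (\<lambda>s. vector_derivative d (at s))"
  have oI: "open I"
    using I by (simp add: open_interval_def)
  have first: "\<gamma> s $ 1 = 0" "d s $ 1 = 0" if "s \<in> I" for s
  proof -
    have B: "x $ 1 = 0" if "x \<in> {vector [0, 1, 0], vector [0, 0, 1]}" for x :: "real^3"
      using that by auto
    show "\<gamma> s $ 1 = 0" "d s $ 1 = 0"
      using curve_in_span_annihilated[OF oI C2 \<gamma> B that] by (simp_all add: d_def)
  qed
  have reg: "(d s $ 2)\<^sup>2 - (d s $ 3)\<^sup>2 \<noteq> 0"
    and eq: "d s $ 2 * d2 s $ 3 - d2 s $ 2 * d s $ 3 =
      \<bar>(d s $ 2)\<^sup>2 - (d s $ 3)\<^sup>2\<bar> * (- v $ 3 * d s $ 2 + v $ 2 * d s $ 3)" if s: "s \<in> I" for s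
  proof -
    obtain n where n: "lorentz n n \<in> {-1, 1}" "lorentz n (d s) = 0" "lorentz n w = 0"
      and D: "lorentz (d s) (d s) * lorentz w w - lorentz (d s) w * lorentz (d s) w \<noteq> 0"
      and eq: "(lorentz (d s) (d s) * lorentz w w - lorentz (d s) w * lorentz (d s) w) *
        lorentz n n * lorentz n v = lorentz w w * lorentz n (d2 s)"
      using soliton_cyl_equation[OF oI C2 sol s] unfolding d2_def d_def by blast
    have n1: "n $ 1 = 0"
      using n(3) by (simp add: lorentz_def w)
    show reg: "(d s $ 2)\<^sup>2 - (d s $ 3)\<^sup>2 \<noteq> 0"
      using D first[OF s] by (simp add: lorentz_def w power2_eq_square)
    show "d s $ 2 * d2 s $ 3 - d2 s $ 2 * d s $ 3 =
      \<bar>(d s $ 2)\<^sup>2 - (d s $ 3)\<^sup>2\<bar> * (- v $ 3 * d s $ 2 + v $ 2 * d s $ 3)"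
      by (rule spacelike_rulings_normal_elimination[of "n $ 2" "n $ 3" "lorentz n n"])
        (use n(1,2) n1 reg eq first[OF s] in \<open>simp_all add: lorentz_def w power2_eq_square\<close>)
  qed
  have "v $ 2 = 0 \<and> (\<forall>s\<in>I. d s $ 2 = 0) \<or>
    parametrizes_as_graph 2 (\<lambda>s y. vector [0, s, y])
        (\<lambda>u' u''. 1 - u'^2 \<noteq> 0 \<and>
          (1 - u'^2 > 0 \<longrightarrow> - u'' = - (1 - u'^2) * (v $ 2 * u' - v $ 3)) \<and>
          (1 - u'^2 < 0 \<longrightarrow> - u'' = (1 - u'^2) * (v $ 2 * u' - v $ 3)))
        \<gamma> w I"
  proof (rule parametrizes_as_graph_or_all_vertical[OF I C2 d_def d2_def,
        where W = "\<lambda>s. \<bar>(d s $ 2)\<^sup>2 - (d s $ 3)\<^sup>2\<bar>" and j = 3 and c = "- v $ 3"])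
    show "continuous_on I (\<lambda>s. \<bar>(d s $ 2)\<^sup>2 - (d s $ 3)\<^sup>2\<bar>)"
      using C2_curve_derivatives(2)[OF C2, folded d_def]
      by (intro continuous_intros continuous_at_imp_continuous_on ballI
          has_vector_derivative_continuous)
    show "d s $ 3 \<noteq> 0" if "s \<in> I" "d s $ 2 = 0" for s
      using reg[OF that(1)] that(2) by auto
    show "\<gamma> s = vector [0, \<gamma> s $ 2, \<gamma> s $ 3]" if "s \<in> I" for s
      using first[OF that] by (simp add: vec_eq_iff forall_3)
    fix s assume s: "s \<in> I" "d s $ 2 \<noteq> 0"
    \<comment> \<open>In terms of the slope \<open>q\<close>, the factor \<open>a\<^sup>2\<close> of \<open>W\<close> comes out of the absolute value.\<close>
    define a q where "a = d s $ 2" and "q = d s $ 3 / d s $ 2"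
    have a: "a \<noteq> 0" "d s $ 3 = q * a"
      using s(2) by (simp_all add: a_def q_def)
    have W: "a\<^sup>2 - (q * a)\<^sup>2 = a\<^sup>2 * (1 - q\<^sup>2)"
      by (simp add: algebra_simps)
    have nz: "1 - q\<^sup>2 \<noteq> 0"
      using reg[OF s(1)] unfolding a(2) unfolding a_def[symmetric] W by auto
    have val: "\<bar>a\<^sup>2 - (q * a)\<^sup>2\<bar> * (- v $ 3 * a + v $ 2 * (q * a)) / a^3 =
        \<bar>1 - q\<^sup>2\<bar> * (v $ 2 * q - v $ 3)"
      unfolding W abs_mult using a(1) by (simp add: field_simps power2_eq_square power3_eq_cube)
    show "1 - (d s $ 3 / d s $ 2)\<^sup>2 \<noteq> 0 \<and>
      (1 - (d s $ 3 / d s $ 2)\<^sup>2 > 0 \<longrightarrow>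
        - (\<bar>(d s $ 2)\<^sup>2 - (d s $ 3)\<^sup>2\<bar> * (- v $ 3 * d s $ 2 + v $ 2 * d s $ 3) / (d s $ 2)^3) =
        - (1 - (d s $ 3 / d s $ 2)\<^sup>2) * (v $ 2 * (d s $ 3 / d s $ 2) - v $ 3)) \<and>
      (1 - (d s $ 3 / d s $ 2)\<^sup>2 < 0 \<longrightarrow>
        - (\<bar>(d s $ 2)\<^sup>2 - (d s $ 3)\<^sup>2\<bar> * (- v $ 3 * d s $ 2 + v $ 2 * d s $ 3) / (d s $ 2)^3) =
        (1 - (d s $ 3 / d s $ 2)\<^sup>2) * (v $ 2 * (d s $ 3 / d s $ 2) - v $ 3))"
      unfolding q_def[symmetric] unfolding a(2) unfolding a_def[symmetric] val
      by (intro conjI impI nz) (simp_all only: abs_of_pos abs_of_neg mult_minus_left minus_minus)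
  qed (use reg eq in auto)
  then show ?thesis
  proof
    assume *: "v $ 2 = 0 \<and> (\<forall>s\<in>I. d s $ 2 = 0)"
    have "d s $ 3 \<noteq> 0" if "s \<in> I" for s
      using reg[OF that] * that by auto
    moreover have "w = axis 1 1"
      by (simp add: w vec_eq_iff forall_3 axis_def)
    moreover have "(UNIV :: 3 set) = {2, 3, 1}"
      using UNIV_3 by auto
    ultimately show ?thesis
      using cylinder_in_coordinate_plane[OF I C2, of 2 3 1 v] * by (simp add: d_def)
  qed blast
qed

lemma timelike_rulings:
  fixes \<gamma> :: "real \<Rightarrow> real^3" and v w :: "real^3"
  assumes I: "open_interval I" and C2: "C2_curve \<gamma> I"
    and w: "w = vector [0, 0, 1]" and \<gamma>: "\<gamma> ` I \<subseteq> span {vector [1, 0, 0], vector [0, 1, 0]}"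
    and sol: "translating_soliton (cyl \<gamma> w) (cyl_domain I) v"
  shows "plane_parallel_to (cyl \<gamma> w ` cyl_domain I) v \<or>
    parametrizes_as_graph 1 (\<lambda>s y. vector [s, y, 0])
        (\<lambda>u' u''. u'' = (1 + u'^2) * (v $ 2 - v $ 1 * u'))
        \<gamma> w I"
proof -
  define d where "d = (\<lambda>s. vector_derivative \<gamma> (at s))"
  define d2 where "d2 = (\<lambda>s. vector_derivative d (at s))"
  have oI: "open I"
    using I by (simp add: open_interval_def)
  have third: "\<gamma> s $ 3 = 0" "d s $ 3 = 0" if "s \<in> I" for s
  proof -
    have B: "x $ 3 = 0" if "x \<in> {vector [1, 0, 0], vector [0, 1, 0]}" for x :: "real^3"
      using that by auto
    show "\<gamma> s $ 3 = 0" "d s $ 3 = 0"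
      using curve_in_span_annihilated[OF oI C2 \<gamma> B that] by (simp_all add: d_def)
  qed
  have reg: "(d s $ 1)\<^sup>2 + (d s $ 2)\<^sup>2 \<noteq> 0"
    and eq: "d s $ 1 * d2 s $ 2 - d2 s $ 1 * d s $ 2 =
      ((d s $ 1)\<^sup>2 + (d s $ 2)\<^sup>2) * (v $ 2 * d s $ 1 + - v $ 1 * d s $ 2)" if s: "s \<in> I" for s
  proof -
    obtain n where n: "lorentz n n \<in> {-1, 1}" "lorentz n (d s) = 0" "lorentz n w = 0"
      and D: "lorentz (d s) (d s) * lorentz w w - lorentz (d s) w * lorentz (d s) w \<noteq> 0"
      and eq: "(lorentz (d s) (d s) * lorentz w w - lorentz (d s) w * lorentz (d s) w) *
        lorentz n n * lorentz n v = lorentz w w * lorentz n (d2 s)"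
      using soliton_cyl_equation[OF oI C2 sol s] unfolding d2_def d_def by blast
    have n3: "n $ 3 = 0"
      using n(3) by (simp add: lorentz_def w)
    have "(n $ 1)\<^sup>2 + (n $ 2)\<^sup>2 \<in> {-1, 1}"
      using n(1) n3 by (simp add: lorentz_def power2_eq_square)
    then have n1: "(n $ 1)\<^sup>2 + (n $ 2)\<^sup>2 = 1"
      using sum_power2_ge_zero[of "n $ 1" "n $ 2"] by auto
    show "(d s $ 1)\<^sup>2 + (d s $ 2)\<^sup>2 \<noteq> 0"
      using D third[OF s] by (auto simp: lorentz_def w power2_eq_square)
    have "lorentz n n = 1"
      using n1 n3 by (simp add: lorentz_def power2_eq_square)
    then have "((d s $ 1)\<^sup>2 + (d s $ 2)\<^sup>2) * (n $ 1 * v $ 1 + n $ 2 * v $ 2) =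
        n $ 1 * d2 s $ 1 + n $ 2 * d2 s $ 2"
      using eq n3 third[OF s] by (simp add: lorentz_def w power2_eq_square algebra_simps)
    moreover have "n $ 1 * d s $ 1 + n $ 2 * d s $ 2 = 0"
      using n(2) n3 by (simp add: lorentz_def)
    ultimately show "d s $ 1 * d2 s $ 2 - d2 s $ 1 * d s $ 2 =
      ((d s $ 1)\<^sup>2 + (d s $ 2)\<^sup>2) * (v $ 2 * d s $ 1 + - v $ 1 * d s $ 2)"
      using timelike_rulings_normal_elimination[OF n1] by blast
  qed
  have "- v $ 1 = 0 \<and> (\<forall>s\<in>I. d s $ 1 = 0) \<or>
    parametrizes_as_graph 1 (\<lambda>s y. vector [s, y, 0])
        (\<lambda>u' u''. u'' = (1 + u'^2) * (v $ 2 - v $ 1 * u'))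
        \<gamma> w I"
  proof (rule parametrizes_as_graph_or_all_vertical[OF I C2 d_def d2_def,
        where W = "\<lambda>s. (d s $ 1)\<^sup>2 + (d s $ 2)\<^sup>2" and j = 2 and c = "v $ 2"])
    show "continuous_on I (\<lambda>s. (d s $ 1)\<^sup>2 + (d s $ 2)\<^sup>2)"
      using C2_curve_derivatives(2)[OF C2, folded d_def]
      by (intro continuous_intros continuous_at_imp_continuous_on ballI
          has_vector_derivative_continuous)
    show "d s $ 2 \<noteq> 0" if "s \<in> I" "d s $ 1 = 0" for s
      using reg[OF that(1)] that(2) by auto
    show "\<gamma> s = vector [\<gamma> s $ 1, \<gamma> s $ 2, 0]" if "s \<in> I" for s
      using third[OF that] by (simp add: vec_eq_iff forall_3)
    fix s assume "s \<in> I" "d s $ 1 \<noteq> 0"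
    then show "((d s $ 1)\<^sup>2 + (d s $ 2)\<^sup>2) * (v $ 2 * d s $ 1 + - v $ 1 * d s $ 2) / (d s $ 1)^3 =
        (1 + (d s $ 2 / d s $ 1)\<^sup>2) * (v $ 2 - v $ 1 * (d s $ 2 / d s $ 1))"
      by (simp add: field_simps power2_eq_square power3_eq_cube)
  qed (use reg eq in auto)
  then show ?thesis
  proof
    assume *: "- v $ 1 = 0 \<and> (\<forall>s\<in>I. d s $ 1 = 0)"
    have "d s $ 2 \<noteq> 0" if "s \<in> I" for s
      using reg[OF that] * that by auto
    moreover have "w = axis 3 1"
      by (simp add: w vec_eq_iff forall_3 axis_def)
    ultimately show ?thesis
      using cylinder_in_coordinate_plane[OF I C2 UNIV_3, of v] * by (simp add: d_def)
  qed blast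
qed

text \<open>For \<open>lorentz w w = 0\<close> the soliton equation reduces to tangency of \<open>v\<close>, that is
  \<open>(d1 - d3) * v2 = (v1 - v3) * d2\<close> for the velocity \<open>d\<close> of the base curve. The factor \<open>d1 - d3\<close> is
  \<open>lorentz d w\<close> and is nonzero by non-degeneracy, so \<open>v1 = v3\<close> forces \<open>v2 = 0\<close>.\<close>

lemma lightlike_rulings_plane_or_parallel:
  fixes \<gamma> :: "real \<Rightarrow> real^3" and v w :: "real^3"
  assumes I: "open_interval I" and C2: "C2_curve \<gamma> I" and w: "w = vector [1, 0, 1]"
    and sol: "translating_soliton (cyl \<gamma> w) (cyl_domain I) v"
  shows "plane_parallel_to (cyl \<gamma> w ` cyl_domain I) v \<or> (\<exists>c. v = c *\<^sub>R w)"
proof -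
  define d where "d = (\<lambda>s. vector_derivative \<gamma> (at s))"
  have oI: "open I"
    using I by (simp add: open_interval_def)
  have reg: "d s $ 1 - d s $ 3 \<noteq> 0"
    and tangent: "(d s $ 1 - d s $ 3) * v $ 2 = (v $ 1 - v $ 3) * d s $ 2" if s: "s \<in> I" for s
  proof -
    obtain n where n: "lorentz n n \<in> {-1, 1}" "lorentz n (d s) = 0" "lorentz n w = 0"
      and D: "lorentz (d s) (d s) * lorentz w w - lorentz (d s) w * lorentz (d s) w \<noteq> 0"
      and eq: "(lorentz (d s) (d s) * lorentz w w - lorentz (d s) w * lorentz (d s) w) *
        lorentz n n * lorentz n v =
        lorentz w w * lorentz n (vector_derivative (\<lambda>r. vector_derivative \<gamma> (at r)) (at s))"
      using soliton_cyl_equation[OF oI C2 sol s] unfolding d_def by blast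
    have null: "lorentz w w = 0"
      by (simp add: lorentz_def w)
    show "d s $ 1 - d s $ 3 \<noteq> 0"
      using D by (simp add: null) (simp add: lorentz_def w)
    have nv: "lorentz n v = 0"
      using eq D n(1) null by auto
    have n3: "n $ 3 = n $ 1"
      using n(3) by (simp add: lorentz_def w)
    have n2: "n $ 2 \<noteq> 0"
      using n(1) n3 by (auto simp: lorentz_def)
    have "n $ 1 * (d s $ 1 - d s $ 3) + n $ 2 * d s $ 2 = 0"
      "n $ 1 * (v $ 1 - v $ 3) + n $ 2 * v $ 2 = 0"
      using n(2) nv n3 by (simp_all add: lorentz_def algebra_simps)
    moreover have "n $ 2 * ((d s $ 1 - d s $ 3) * v $ 2 - (v $ 1 - v $ 3) * d s $ 2) =
        (d s $ 1 - d s $ 3) * (n $ 1 * (v $ 1 - v $ 3) + n $ 2 * v $ 2) -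
        (v $ 1 - v $ 3) * (n $ 1 * (d s $ 1 - d s $ 3) + n $ 2 * d s $ 2)"
      by (simp add: algebra_simps)
    ultimately have "n $ 2 * ((d s $ 1 - d s $ 3) * v $ 2 - (v $ 1 - v $ 3) * d s $ 2) = 0"
      by simp
    then show "(d s $ 1 - d s $ 3) * v $ 2 = (v $ 1 - v $ 3) * d s $ 2"
      using n2 by simp
  qed
  obtain s0 where s0: "s0 \<in> I"
    using I by (auto simp: open_interval_def)
  show ?thesis
  proof (cases "v $ 1 = v $ 3")
    case True
    then have "v $ 2 = 0"
      using tangent[OF s0] reg[OF s0] by simp
    then have "v = (v $ 1) *\<^sub>R w"
      using True by (simp add: w vec_eq_iff forall_3)
    then show ?thesis
      by blast
  next
    case False
    \<comment> \<open>\<open>?m\<close> is a Euclidean normal of the span of \<open>v\<close> and \<open>w\<close>; \<open>?f\<close> represents \<open>\<lambda>x. lorentz x w\<close>.\<close>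
    let ?m = "vector [v $ 2, v $ 3 - v $ 1, - v $ 2] :: real^3"
    let ?f = "vector [1, 0, -1] :: real^3"
    have "plane_parallel_to (cyl \<gamma> w ` cyl_domain I) v"
    proof (rule cylinder_in_plane[OF I C2, of ?m _ _ ?f, folded d_def])
      show "?m \<noteq> 0"
        using False by (simp add: vec_eq_iff forall_3)
      show "inner ?m w = 0" "inner ?f w = 0"
        by (simp_all add: inner_vec_def sum_3 w)
      show "inner ?m v = 0"
        by (simp add: inner_vec_def sum_3 algebra_simps)
      show "inner ?m (vector_derivative \<gamma> (at s)) = 0" if "s \<in> I" for s
        using tangent[OF that] by (simp add: inner_vec_def sum_3 d_def algebra_simps)
      show "inner ?f (vector_derivative \<gamma> (at s)) \<noteq> 0" if "s \<in> I" for s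
        using reg[OF that] by (simp add: inner_vec_def sum_3 d_def)
      fix y :: "real^3"
      assume "inner ?m y = 0" "inner ?f y = 0"
      then have y: "y $ 1 = y $ 3" "v $ 2 * (y $ 1 - y $ 3) + (v $ 3 - v $ 1) * y $ 2 = 0"
        by (simp_all add: inner_vec_def sum_3 algebra_simps)
      then have "y $ 2 = 0"
        using False by simp
      then have "y = (y $ 1) *\<^sub>R w"
        using y(1) by (simp add: w vec_eq_iff forall_3)
      then show "\<exists>t. y = t *\<^sub>R w"
        by blast
    qed
    then show ?thesis ..
  qed
qed

text \<open>The mean curvature vanishes for every base curve, and a normal field is orthogonal to \<open>w\<close>, so both
  sides of the soliton equation are zero. What remains is to exhibit a continuous unit normal field.\<close>

lemma lightlike_rulings_arbitrary_base_curve: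
  fixes \<beta> :: "real \<Rightarrow> real^3" and w :: "real^3"
  assumes J: "open_interval J" and C2: "C2_curve \<beta> J" and w: "w = vector [1, 0, 1]"
    and nondeg: "nondegenerate_surface (cyl \<beta> w) (cyl_domain J)"
  shows "translating_soliton (cyl \<beta> w) (cyl_domain J) (c *\<^sub>R w)"
proof -
  define d where "d = (\<lambda>s. vector_derivative \<beta> (at s))"
  have oJ: "open J"
    using J by (simp add: open_interval_def)
  have null: "lorentz w w = 0"
    by (simp add: lorentz_def w)
  have det: "det (induced_metric (cyl \<beta> w) p) \<noteq> 0" if "p \<in> cyl_domain J" for p
    using nondeg that by (simp add: nondegenerate_surface_def)
  have mem: "p $ 1 \<in> J" if "p \<in> cyl_domain J" for p
    using that by (simp add: cyl_domain_def)
  have reg: "d s $ 1 - d s $ 3 \<noteq> 0" if "s \<in> J" for s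
  proof -
    have "axis 1 s \<in> cyl_domain J"
      using that by (simp add: cyl_domain_def)
    from det[OF this] det_induced_metric_cyl[OF oJ C2 this, of w]
    show ?thesis
      unfolding null by (auto simp: lorentz_def w d_def)
  qed
  \<comment> \<open>The orthogonal complement of \<open>w\<close> is spanned by \<open>axis 2 1\<close> and \<open>w\<close> itself; the multiple of the null
    vector \<open>w\<close> that makes the unit vector \<open>axis 2 1\<close> orthogonal to the base curve does not change
    its length.\<close>
  define N where "N = (\<lambda>p::real^2. axis 2 1 -
      (d (p $ 1) $ 2 / (d (p $ 1) $ 1 - d (p $ 1) $ 3)) *\<^sub>R w)"
  have N: "N p $ 1 = - (d (p $ 1) $ 2 / (d (p $ 1) $ 1 - d (p $ 1) $ 3))" "N p $ 2 = 1"
    "N p $ 3 = - (d (p $ 1) $ 2 / (d (p $ 1) $ 1 - d (p $ 1) $ 3))" for p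
    by (simp_all add: N_def w axis_def)
  have Nw: "lorentz (N p) w = 0" for p
    by (simp add: lorentz_def N w)
  have "continuous_on J d"
    using C2_curve_derivatives(2)[OF C2, folded d_def]
    by (intro continuous_at_imp_continuous_on ballI has_vector_derivative_continuous)
  then have "continuous_on (cyl_domain J) (\<lambda>p. d (p $ 1))"
    by (rule continuous_on_compose2) (auto intro!: continuous_intros mem)
  then have "continuous_on (cyl_domain J) N"
    unfolding N_def by (intro continuous_intros) (auto dest: reg[OF mem])
  moreover have "lorentz (N p) (N p) \<in> {-1, 1} \<and> (\<forall>i. lorentz (N p) (partial i (cyl \<beta> w) p) = 0)"
    if p: "p \<in> cyl_domain J" for p
  proof -
    have "lorentz (N p) (N p) = 1"
      by (simp add: lorentz_def N)
    moreover have "lorentz (N p) (d (p $ 1)) = 0"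
      using reg[OF mem[OF p]] by (simp add: lorentz_def N field_simps)
    ultimately show ?thesis
      using partial_cyl[OF oJ C2 p, of w] Nw[of p] by (simp add: forall_2 d_def)
  qed
  ultimately have "unit_normal_field (cyl \<beta> w) (cyl_domain J) N"
    by (simp add: unit_normal_field_def)
  moreover have "mean_curvature_vector (cyl \<beta> w) p = 0 *\<^sub>R N p \<and> 2 * 0 = lorentz (N p) (c *\<^sub>R w)"
    if p: "p \<in> cyl_domain J" for p
    using det_times_mean_curvature_cyl[OF oJ C2 p det[OF p]] det[OF p] null Nw[of p]
    by (simp add: bounded_bilinear.scaleR_right[OF bounded_bilinear_lorentz])
  ultimately show ?thesis
    unfolding translating_soliton_def using nondeg by (intro conjI exI[of _ N] exI[of _ "\<lambda>_. 0"]) auto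
qed

theorem theorem3p1:
  fixes \<gamma> :: "real \<Rightarrow> real^3" and w v :: "real^3" and I :: "real set"
  assumes "normalized_cylinder \<gamma> w I"
    and "translating_soliton (cyl \<gamma> w) (cyl_domain I) v"
  shows "plane_parallel_to (cyl \<gamma> w ` cyl_domain I) v \<or>
    (w = vector [1, 0, 0] \<and>
      parametrizes_as_graph 2 (\<lambda>s y. vector [0, s, y])
        (\<lambda>u' u''. 1 - u'^2 \<noteq> 0 \<and>
          (1 - u'^2 > 0 \<longrightarrow> - u'' = - (1 - u'^2) * (v $ 2 * u' - v $ 3)) \<and>
          (1 - u'^2 < 0 \<longrightarrow> - u'' = (1 - u'^2) * (v $ 2 * u' - v $ 3)))
        \<gamma> w I) \<or>
    (w = vector [0, 0, 1] \<and>
      parametrizes_as_graph 1 (\<lambda>s y. vector [s, y, 0])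
        (\<lambda>u' u''. u'' = (1 + u'^2) * (v $ 2 - v $ 1 * u'))
        \<gamma> w I) \<or>
    (w = vector [1, 0, 1] \<and>
      (plane_parallel_to (cyl \<gamma> w ` cyl_domain I) v \<or>
       (\<exists>c. v = c *\<^sub>R w) \<and>
       (\<forall>\<beta> J. normalized_cylinder \<beta> w J \<and> nondegenerate_surface (cyl \<beta> w) (cyl_domain J)
          \<longrightarrow> translating_soliton (cyl \<beta> w) (cyl_domain J) v)))"
proof -
  have I: "open_interval I" and C2: "C2_curve \<gamma> I"
    using assms(1) by (auto simp: normalized_cylinder_def)
  consider
    (spacelike) "w = vector [1, 0, 0]" "\<gamma> ` I \<subseteq> span {vector [0, 1, 0], vector [0, 0, 1]}"
  | (timelike) "w = vector [0, 0, 1]" "\<gamma> ` I \<subseteq> span {vector [1, 0, 0], vector [0, 1, 0]}"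
  | (lightlike) "w = vector [1, 0, 1]"
    using assms(1) by (auto simp: normalized_cylinder_def)
  then show ?thesis
  proof cases
    case spacelike
    then show ?thesis
      using spacelike_rulings[OF I C2 spacelike assms(2)] by blast
  next
    case timelike
    then show ?thesis
      using timelike_rulings[OF I C2 timelike assms(2)] by blast
  next
    case lightlike
    have "translating_soliton (cyl \<beta> w) (cyl_domain J) (c *\<^sub>R w)"
      if "normalized_cylinder \<beta> w J" "nondegenerate_surface (cyl \<beta> w) (cyl_domain J)" for \<beta> J c
      using that lightlike_rulings_arbitrary_base_curve[OF _ _ lightlike]
      by (simp add: normalized_cylinder_def)
    then show ?thesis
      using lightlike_rulings_plane_or_parallel[OF I C2 lightlike assms(2)] lightlike by blast
  qed
qed

end
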